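(* For all $m\ge1$, $G(\mathcal D_m,\mathbf 1,\psi_1)$ is conjugate in $\mathrm U_2(\mathbb H)$ to $G(\mathcal C_{2m},\mathcal C_2,\varphi)\simeq\mathrm{ST}(2m,m,2)$, where $\varphi$ is inversion (i.e. $\varphi(\mathcal C_2\xi)=\mathcal C_2\xi^{-1}$). For all $r\in\mathbb R$, the reflections $R_{r,i}$ normalise $G(\mathcal D_m,\mathbf 1,\psi_1)$.
   Context: $\mathbb H$ is the real quaternion algebra with units $i,j,k$, and $\mathbb S^3$ is the group of quaternions of norm $1$; $\mathbb C$ is identified with $\mathbb R+\mathbb Ri\subset\mathbb H$. $\mathrm U_2(\mathbb H)$ is the group of $2\times2$ quaternionic matrices $A$ with $A\overline A^{\top}=I$. For a finite subgroup $K$ of $\mathbb S^3$, $H\trianglelefteq K$ and $\varphi\in\mathrm{Aut}(K/H)$ with $\varphi^2=1$, $G(K,H,\varphi)\subset \mathrm U_2(\mathbb H)$ is the group of order $2|K||H|$ consisting of all matrices $\mathrm{diag}(\xi,\eta)$ with $\xi,\eta\in K$, $\varphi(H\xi)=H\eta$, together with their products with $\begin{pmatrix}0&1\\1&0\end{pmatrix}$. Here $\mathbf 1$ denotes the trivial group. Let $\zeta_q=\cos(2\pi/q)+i\sin(2\pi/q)$, $\mathcal C_q=\langle\zeta_q\rangle$, $\mathcal D_m=\langle\zeta_{2m},j\rangle$ (order $4m$). $\psi_1$ is the automorphism of $\mathcal D_m$ with $\psi_1(\zeta_{2m})=\zeta_{2m}$ and $\psi_1(j)=j^{-1}$. $\mathrm{ST}(m,p,2)$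 (with $p\mid m$) denotes the imprimitive complex reflection group $G(m,p,2)$ of Shephard and Todd (monomial $2\times2$ matrices whose non-zero entries are $m$-th roots of unity with product an $(m/p)$-th root of unity), regarded as a subgroup of $\mathrm U_2(\mathbb H)$. For $r\in\mathbb R$, $R_{r,i}=\frac1{\sqrt{1+r^2}}\begin{pmatrix}1&ri\\-ri&-1\end{pmatrix}$. *)

theory Defs
  imports "HOL-Analysis.Analysis" "HOL-Algebra.Group_Action" "HOL-Algebra.Generated_Groups"
begin

section \<open>Real quaternions\<close>

text \<open>\<open>Quat a b c d\<close> stands for \<open>a + b i + c j + d k\<close>.\<close>

datatype quat = Quat (qRe: real) (qI: real) (qJ: real) (qK: real)

lemma quat_eq_iff: "p = q \<longleftrightarrow> qRe p = qRe q \<and> qI p = qI q \<and> qJ p = qJ q \<and> qK p = qK q"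
  by (cases p; cases q) simp

instantiation quat :: real_algebra_1
begin

definition zero_quat where "0 = Quat 0 0 0 0"
definition one_quat where "1 = Quat 1 0 0 0"
definition plus_quat where "p + q = Quat (qRe p + qRe q) (qI p + qI q) (qJ p + qJ q) (qK p + qK q)"
definition uminus_quat where "- p = Quat (- qRe p) (- qI p) (- qJ p) (- qK p)"
definition minus_quat where "p - q = Quat (qRe p - qRe q) (qI p - qI q) (qJ p - qJ q) (qK p - qK q)"
definition scaleR_quat where "r *\<^sub>R p = Quat (r * qRe p) (r * qI p) (r * qJ p) (r * qK p)"
definition times_quat where
  "p * q = Quat
     (qRe p * qRe q - qI p * qI q - qJ p * qJ q - qK p * qK q)
     (qRe p * qI q + qI p * qRe q + qJ p * qK q - qK p * qJ q)
     (qRe p * qJ q - qI p * qK q + qJ p * qRe q + qK p * qI q)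
     (qRe p * qK q + qI p * qJ q - qJ p * qI q + qK p * qRe q)"

lemmas quat_ops = zero_quat_def one_quat_def plus_quat_def uminus_quat_def minus_quat_def
  scaleR_quat_def times_quat_def

instance
  by standard (simp_all add: quat_ops quat_eq_iff algebra_simps)

end

lemma quat_sel_simps [simp]:
  "qRe 0 = 0" "qI 0 = 0" "qJ 0 = 0" "qK 0 = 0"
  "qRe 1 = 1" "qI 1 = 0" "qJ 1 = 0" "qK 1 = 0"
  "qRe (p + q) = qRe p + qRe q" "qI (p + q) = qI p + qI q"
  "qJ (p + q) = qJ p + qJ q" "qK (p + q) = qK p + qK q"
  "qRe (p - q) = qRe p - qRe q" "qI (p - q) = qI p - qI q"
  "qJ (p - q) = qJ p - qJ q" "qK (p - q) = qK p - qK q"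
  "qRe (- p) = - qRe p" "qI (- p) = - qI p" "qJ (- p) = - qJ p" "qK (- p) = - qK p"
  "qRe (r *\<^sub>R p) = r * qRe p" "qI (r *\<^sub>R p) = r * qI p"
  "qJ (r *\<^sub>R p) = r * qJ p" "qK (r *\<^sub>R p) = r * qK p"
  by (simp_all add: quat_ops)

lemma quat_sel_times:
  "qRe (p * q) = qRe p * qRe q - qI p * qI q - qJ p * qJ q - qK p * qK q"
  "qI (p * q) = qRe p * qI q + qI p * qRe q + qJ p * qK q - qK p * qJ q"
  "qJ (p * q) = qRe p * qJ q - qI p * qK q + qJ p * qRe q + qK p * qI q"
  "qK (p * q) = qRe p * qK q + qI p * qJ q - qJ p * qI q + qK p * qRe q"
  by (simp_all add: times_quat_def)

definition quat_i :: quat where "quat_i = Quat 0 1 0 0"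
definition quat_j :: quat where "quat_j = Quat 0 0 1 0"

definition quat_of_complex :: "complex \<Rightarrow> quat" where
  "quat_of_complex z = Quat (Re z) (Im z) 0 0"

definition qcnj :: "quat \<Rightarrow> quat" where
  "qcnj p = Quat (qRe p) (- qI p) (- qJ p) (- qK p)"

definition qnorm :: "quat \<Rightarrow> real" where
  "qnorm p = sqrt ((qRe p)\<^sup>2 + (qI p)\<^sup>2 + (qJ p)\<^sup>2 + (qK p)\<^sup>2)"

lemma qcnj_sel [simp]:
  "qRe (qcnj p) = qRe p" "qI (qcnj p) = - qI p" "qJ (qcnj p) = - qJ p" "qK (qcnj p) = - qK p"
  by (simp_all add: qcnj_def)

lemma qcnj_mult: "qcnj (p * q) = qcnj q * qcnj p"
  by (simp add: quat_eq_iff quat_sel_times algebra_simps)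

lemma qcnj_0 [simp]: "qcnj 0 = 0" and qcnj_1 [simp]: "qcnj 1 = 1"
  and qcnj_add: "qcnj (p + q) = qcnj p + qcnj q" and qcnj_qcnj [simp]: "qcnj (qcnj p) = p"
  by (simp_all add: quat_eq_iff)

lemma mult_qcnj: "p * qcnj p = of_real ((qnorm p)\<^sup>2)" and qcnj_mult_self: "qcnj p * p = of_real ((qnorm p)\<^sup>2)"
  by (simp_all add: quat_eq_iff quat_sel_times qnorm_def of_real_def power2_eq_square algebra_simps)

lemma qnorm_nonneg [simp]: "0 \<le> qnorm p"
  by (simp add: qnorm_def)

lemma qnorm_eq_0_iff [simp]: "qnorm p = 0 \<longleftrightarrow> p = 0"
  by (simp add: qnorm_def quat_eq_iff add_nonneg_eq_0_iff)

lemma qnorm_0 [simp]: "qnorm 0 = 0" and qnorm_1 [simp]: "qnorm 1 = 1"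
  by (simp_all add: qnorm_def)

lemma qnorm_qcnj [simp]: "qnorm (qcnj p) = qnorm p"
  by (simp add: qnorm_def)

lemma qnorm_minus [simp]: "qnorm (- p) = qnorm p"
  by (simp add: qnorm_def)

lemma qnorm_mult: "qnorm (p * q) = qnorm p * qnorm q"
  by (simp add: qnorm_def real_sqrt_mult [symmetric] quat_sel_times power2_eq_square algebra_simps)

section \<open>The groups of unit quaternions and of unitary quaternionic matrices\<close>

definition S3 :: "quat monoid" where
  "S3 = \<lparr>carrier = {q. qnorm q = 1}, mult = (*), one = 1\<rparr>"

definition conj_transpose :: "quat^'n^'m \<Rightarrow> quat^'m^'n" where
  "conj_transpose A = (\<chi> a b. qcnj (A $ b $ a))"

definition U2H :: "(quat^2^2) monoid" where
  "U2H = \<lparr>carrier = {A. A ** conj_transpose A = mat 1}, mult = (**), one = mat 1\<rparr>"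

lemma group_S3: "group S3"
proof (rule groupI)
  fix x assume "x \<in> carrier S3"
  then show "\<exists>y\<in>carrier S3. y \<otimes>\<^bsub>S3\<^esub> x = \<one>\<^bsub>S3\<^esub>"
    by (intro bexI[of _ "qcnj x"]) (auto simp: S3_def qcnj_mult_self)
qed (auto simp: S3_def qnorm_mult mult.assoc)

lemma conj_transpose_mult:
  fixes A :: "quat^2^2"
  shows "conj_transpose (A ** B) = conj_transpose B ** conj_transpose A"
  by (simp add: vec_eq_iff conj_transpose_def matrix_matrix_mult_def UNIV_2 qcnj_mult qcnj_add)

lemma conj_transpose_conj_transpose [simp]: "conj_transpose (conj_transpose A) = A"
  by (simp add: vec_eq_iff conj_transpose_def)

text \<open>Right inverse implies left inverse; the commutative library result does not apply.\<close>

lemma U2H_left_inverse: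
  fixes A :: "quat^2^2"
  assumes "A ** conj_transpose A = mat 1"
  shows "conj_transpose A ** A = mat 1"
proof -
  define a b c d where abcd: "a = A$1$1" "b = A$1$2" "c = A$2$1" "d = A$2$2"
  have e1: "a * qcnj a + b * qcnj b = 1" and e2: "c * qcnj c + d * qcnj d = 1"
    and e3: "a * qcnj c + b * qcnj d = 0"
    using assms
    by (simp_all add: vec_eq_iff conj_transpose_def matrix_matrix_mult_def UNIV_2 mat_def forall_2 abcd)
  define x y where xy: "x = (qnorm a)\<^sup>2" "y = (qnorm c)\<^sup>2"
  have ofr: "(of_real r :: quat) = of_real s \<longleftrightarrow> r = s" for r s by simp
  have b: "(qnorm b)\<^sup>2 = 1 - x" and d: "(qnorm d)\<^sup>2 = 1 - y"
    using e1 e2 unfolding mult_qcnj xy of_real_add[symmetric] of_real_1[symmetric, where ?'a=quat] ofr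
    by linarith+
  have "a * qcnj c = - (b * qcnj d)"
    using e3 by (simp add: eq_neg_iff_add_eq_0)
  then have "qnorm a * qnorm c = qnorm b * qnorm d"
    by (metis qnorm_mult qnorm_minus qnorm_qcnj)
  then have "x * y = (1 - x) * (1 - y)"
    unfolding xy b[unfolded xy, symmetric] d[unfolded xy, symmetric] by (metis power_mult_distrib)
  then have sum1: "x + y = 1" by (simp add: algebra_simps)
  have f1: "qcnj a * a + qcnj c * c = 1" and f2: "qcnj b * b + qcnj d * d = 1"
    using b d sum1 by (simp_all add: qcnj_mult_self of_real_add[symmetric] xy del: of_real_add of_real_power of_real_diff)
  have f3: "qcnj a * b + qcnj c * d = 0"
  proof (cases "c = 0")
    case True
    then have "qnorm b = 0" using b sum1 xy by simp
    with True show ?thesis by simp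
  next
    case False
    have y0: "y \<noteq> 0" using False xy by simp
    have "c * qcnj a + d * qcnj b = 0"
      using arg_cong[OF e3, of qcnj] by (simp add: qcnj_add qcnj_mult)
    then have "qcnj c * (c * qcnj a + d * qcnj b) * b = 0" by simp
    then have "(qcnj c * c) * qcnj a * b + qcnj c * d * (qcnj b * b) = 0"
      by (simp add: algebra_simps)
    moreover have "(qcnj c * c) = of_real y" "(qcnj b * b) = of_real y"
      using b sum1 by (simp_all add: qcnj_mult_self xy del: of_real_power of_real_diff)
    ultimately have "y *\<^sub>R (qcnj a * b + qcnj c * d) = 0"
      by (simp add: of_real_def algebra_simps)
    with y0 show ?thesis by simp
  qed
  have f4: "qcnj b * a + qcnj d * c = 0"
    using arg_cong[OF f3, of qcnj] by (simp add: qcnj_add qcnj_mult)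
  show ?thesis
    using f1 f2 f3 f4
    by (simp add: vec_eq_iff conj_transpose_def matrix_matrix_mult_def UNIV_2 mat_def forall_2 abcd)
qed

lemma group_U2H: "group U2H"
proof (rule groupI)
  fix A B assume "A \<in> carrier U2H" "B \<in> carrier U2H"
  then have A: "A ** conj_transpose A = mat 1" and B: "B ** conj_transpose B = mat 1"
    by (auto simp: U2H_def)
  have "(A ** B) ** conj_transpose (A ** B) = A ** (B ** conj_transpose B) ** conj_transpose A"
    by (simp add: conj_transpose_mult matrix_mul_assoc)
  then show "A \<otimes>\<^bsub>U2H\<^esub> B \<in> carrier U2H"
    by (simp add: U2H_def A B)
next
  fix A assume "A \<in> carrier U2H"
  then show "\<exists>B\<in>carrier U2H. B \<otimes>\<^bsub>U2H\<^esub> A = \<one>\<^bsub>U2H\<^esub>"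
    by (intro bexI[of _ "conj_transpose A"]) (auto simp: U2H_def U2H_left_inverse)
qed (auto simp: U2H_def matrix_mul_assoc,
     simp add: vec_eq_iff conj_transpose_def matrix_matrix_mult_def UNIV_2 mat_def forall_2)

definition conjugate_in :: "('a, 'b) monoid_scheme \<Rightarrow> 'a set \<Rightarrow> 'a set \<Rightarrow> bool" where
  "conjugate_in G A B \<longleftrightarrow> (\<exists>g\<in>carrier G. B = g <#\<^bsub>G\<^esub> A #>\<^bsub>G\<^esub> (inv\<^bsub>G\<^esub> g))"

text \<open>A reflection fixes pointwise a hyperplane (for \<open>2 \<times> 2\<close> matrices, a line) and nothing else.
  Matrices act on column vectors from the left, so subspaces are right subspaces.\<close>

definition is_reflection :: "quat^2^2 \<Rightarrow> bool" where
  "is_reflection A \<longleftrightarrow> A \<in> carrier U2H \<and>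
     (\<exists>v. v \<noteq> 0 \<and> {x. A *v x = x} = {\<chi> l. v $ l * q | q. True})"

section \<open>The imprimitive groups\<close>

definition qmat2 :: "'a::zero \<Rightarrow> 'a \<Rightarrow> 'a \<Rightarrow> 'a \<Rightarrow> 'a^2^2" where
  "qmat2 a b c d = vector [vector [a, b], vector [c, d]]"

text \<open>\<open>\<phi>\<close> acts on cosets, i.e. on the carrier of the quotient \<open>S3\<lparr>carrier := K\<rparr> Mod H\<close>. The definition
  is meant for finite subgroups \<open>K\<close>, normal \<open>H\<close> in \<open>K\<close> and \<open>\<phi>\<close> an automorphism of that
  quotient with \<open>\<phi> \<circ> \<phi> = id\<close>.\<close>

definition imprim_group :: "quat set \<Rightarrow> quat set \<Rightarrow> (quat set \<Rightarrow> quat set) \<Rightarrow> (quat^2^2) set" where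
  "imprim_group K H \<phi> =
     (let T = {qmat2 \<xi> 0 0 \<eta> | \<xi> \<eta>. \<xi> \<in> K \<and> \<eta> \<in> K \<and> \<phi> (H #>\<^bsub>S3\<^esub> \<xi>) = H #>\<^bsub>S3\<^esub> \<eta>}
      in T \<union> (\<lambda>A. A ** qmat2 0 1 1 0) ` T)"

definition qzeta :: "nat \<Rightarrow> quat" where
  "qzeta q = Quat (cos (2 * pi / real q)) (sin (2 * pi / real q)) 0 0"

definition cyclic_C :: "nat \<Rightarrow> quat set" where
  "cyclic_C q = generate S3 {qzeta q}"

definition bindihedral_D :: "nat \<Rightarrow> quat set" where
  "bindihedral_D m = generate S3 {qzeta (2 * m), quat_j}"

text \<open>Elements of \<^const>\<open>auto\<close> are extensional, so \<open>psi1 m\<close> is \<^const>\<open>undefined\<close>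
  outside \<open>bindihedral_D m\<close>.\<close>

definition psi1 :: "nat \<Rightarrow> quat \<Rightarrow> quat" where
  "psi1 m = (THE \<psi>. \<psi> \<in> auto (S3\<lparr>carrier := bindihedral_D m\<rparr>) \<and>
     \<psi> (qzeta (2 * m)) = qzeta (2 * m) \<and> \<psi> quat_j = inv\<^bsub>S3\<^esub> quat_j)"

lemma psi1_ex1:
  "\<exists>!\<psi>. \<psi> \<in> auto (S3\<lparr>carrier := bindihedral_D m\<rparr>) \<and>
     \<psi> (qzeta (2 * m)) = qzeta (2 * m) \<and> \<psi> quat_j = inv\<^bsub>S3\<^esub> quat_j"
proof -
  interpret S: group S3 by (rule group_S3)
  define Z where "Z = qzeta (2 * m)"
  define D where "D = bindihedral_D m"
  have Dgen: "D = generate S3 {Z, quat_j}"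
    by (simp add: D_def bindihedral_D_def Z_def)
  have Zc: "Z \<in> carrier S3" and jc: "quat_j \<in> carrier S3"
    by (simp_all add: Z_def S3_def qzeta_def quat_j_def qnorm_def)
  have sub: "subgroup D S3"
    unfolding Dgen by (rule S.generate_is_subgroup) (use Zc jc in auto)
  interpret D: group "S3\<lparr>carrier := D\<rparr>"
    by (rule S.subgroup_imp_group[OF sub])
  have ZD: "Z \<in> D" and jD: "quat_j \<in> D"
    unfolding Dgen by (auto intro: generate.incl)
  have invD: "inv\<^bsub>S3\<lparr>carrier := D\<rparr>\<^esub> x = inv\<^bsub>S3\<^esub> x" if "x \<in> D" for x
    by (rule S.m_inv_consistent[OF sub that])
  have invj: "inv\<^bsub>S3\<^esub> quat_j = - quat_j"
    by (rule S.inv_equality) (use jc in \<open>auto simp: S3_def quat_j_def quat_eq_iff quat_sel_times\<close>)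
  define c where "c = (\<lambda>q. Quat (qRe q) (qI q) (- qJ q) (- qK q))"
  have c_mult: "c (x * y) = c x * c y" for x y
    by (simp add: c_def quat_eq_iff quat_sel_times)
  have c_c: "c (c x) = x" for x by (simp add: c_def)
  have c_Z: "c Z = Z" by (simp add: c_def Z_def qzeta_def)
  have c_j: "c quat_j = inv\<^bsub>S3\<^esub> quat_j" unfolding invj by (simp add: c_def quat_j_def quat_eq_iff)
  have c_S: "c x \<in> carrier S3" if "x \<in> carrier S3" for x
    using that by (simp add: c_def S3_def qnorm_def)
  have mS: "x \<otimes>\<^bsub>S3\<^esub> y = x * y" for x y by (simp add: S3_def)
  have c_inv: "c (inv\<^bsub>S3\<^esub> x) = inv\<^bsub>S3\<^esub> (c x)" if "x \<in> carrier S3" for x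
  proof (rule S.inv_equality[symmetric])
    show "c (inv\<^bsub>S3\<^esub> x) \<otimes>\<^bsub>S3\<^esub> c x = \<one>\<^bsub>S3\<^esub>"
      using S.l_inv[OF that] unfolding mS c_mult[symmetric] by (simp add: S3_def c_def quat_eq_iff)
  qed (use that c_S in auto)
  have c_D: "c x \<in> D" if "x \<in> D" for x
    using that unfolding Dgen
  proof (induction rule: generate.induct)
    case one
    then show ?case using generate.one[of S3] by (simp add: S3_def c_def one_quat_def)
  next
    case (incl h)
    then show ?case
      using subgroup.m_inv_closed[OF sub jD] ZD by (auto simp: c_Z c_j Dgen)
  next
    case (inv h)
    then have "h = Z \<or> h = quat_j" by auto
    then show ?case
      using subgroup.m_inv_closed[OF sub ZD] jD jc Zc
      by (auto simp: c_inv c_Z c_j Dgen)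
  next
    case (eng h1 h2)
    then show ?case by (simp add: mS c_mult) (metis generate.eng mS)
  qed
  have ext: "\<psi> = restrict c D"
    if \<psi>: "\<psi> \<in> auto (S3\<lparr>carrier := D\<rparr>)" "\<psi> Z = Z" "\<psi> quat_j = inv\<^bsub>S3\<^esub> quat_j" for \<psi>
  proof (rule extensionalityI[of _ D])
    have hom: "\<psi> \<in> hom (S3\<lparr>carrier := D\<rparr>) (S3\<lparr>carrier := D\<rparr>)"
      using \<psi>(1) by (simp add: auto_def)
    interpret h: group_hom "S3\<lparr>carrier := D\<rparr>" "S3\<lparr>carrier := D\<rparr>" \<psi>
      by unfold_locales (rule hom)
    fix x assume "x \<in> D"
    have "x \<in> D \<and> \<psi> x = c x"
      using \<open>x \<in> D\<close>[unfolded Dgen]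
    proof (induction rule: generate.induct)
      case one
      have "\<psi> \<one>\<^bsub>S3\<^esub> = \<one>\<^bsub>S3\<^esub>" using h.hom_one by simp
      then show ?case
        using subgroup.one_closed[OF sub] by (simp add: S3_def c_def quat_eq_iff)
    next
      case (incl h)
      then show ?case using ZD jD \<psi> c_Z c_j by auto
    next
      case (inv h)
      then have hD: "h \<in> D" and e: "\<psi> h = c h" using ZD jD \<psi> c_Z c_j by auto
      have "\<psi> (inv\<^bsub>S3\<^esub> h) = inv\<^bsub>S3\<^esub> (\<psi> h)"
        using h.hom_inv[of h] hD h.hom_closed[of h] by (simp add: invD)
      then show ?case
        using hD e subgroup.m_inv_closed[OF sub hD] subgroup.subset[OF sub] by (auto simp: c_inv)
    next
      case (eng h1 h2)
      then show ?case
        using h.hom_mult[of h1 h2] subgroup.m_closed[OF sub] by (auto simp: mS c_mult)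
    qed
    then show "\<psi> x = restrict c D x" using \<open>x \<in> D\<close> by simp
  qed (use \<psi> in \<open>auto simp: auto_def Bij_def\<close>)
  have "bij_betw (restrict c D) D D"
    by (rule bij_betw_byWitness[of _ c]) (auto simp: c_c c_D)
  then have "restrict c D \<in> auto (S3\<lparr>carrier := D\<rparr>)"
    using subgroup.m_closed[OF sub]
    by (auto simp: auto_def Bij_def hom_def c_D mS c_mult)
  moreover have "restrict c D Z = Z" "restrict c D quat_j = inv\<^bsub>S3\<^esub> quat_j"
    using ZD jD by (simp_all add: c_Z c_j)
  ultimately show ?thesis
    using ext unfolding D_def Z_def by blast
qed

text \<open>The automorphism of \<open>K/H\<close> induced by \<open>\<psi>\<close> on \<open>K\<close> is \<open>X \<mapsto> \<psi> ` X\<close>.\<close>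

definition G_D_psi1 :: "nat \<Rightarrow> (quat^2^2) set" where
  "G_D_psi1 m = imprim_group (bindihedral_D m) {1} (\<lambda>X. psi1 m ` X)"

text \<open>Inversion on the quotient group: \<open>H \<xi> \<mapsto> (H \<xi>)\<inverse> = H \<xi>\<inverse>\<close>.\<close>

definition G_C_inv :: "nat \<Rightarrow> (quat^2^2) set" where
  "G_C_inv m = imprim_group (cyclic_C (2 * m)) (cyclic_C 2)
     (\<lambda>X. inv\<^bsub>S3\<lparr>carrier := cyclic_C (2 * m)\<rparr> Mod cyclic_C 2\<^esub> X)"

text \<open>The Shephard--Todd group \<open>G(m,p,2)\<close>, for \<open>p\<close> dividing \<open>m\<close>. The first line says that
  \<open>A\<close> is monomial; the last product runs over the positions of the two non-zero entries.\<close>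

definition shephard_todd :: "nat \<Rightarrow> nat \<Rightarrow> (complex^2^2) set" where
  "shephard_todd m p = {A.
     (\<forall>a. \<exists>!b. A $ a $ b \<noteq> 0) \<and> (\<forall>b. \<exists>!a. A $ a $ b \<noteq> 0) \<and>
     (\<forall>a b. A $ a $ b \<noteq> 0 \<longrightarrow> (A $ a $ b) ^ m = 1) \<and>
     (\<Prod>(a, b)\<in>{(a, b). A $ a $ b \<noteq> 0}. A $ a $ b) ^ (m div p) = 1}"

definition ST :: "nat \<Rightarrow> nat \<Rightarrow> (quat^2^2) set" where
  "ST m p = (\<lambda>A. \<chi> a b. quat_of_complex (A $ a $ b)) ` shephard_todd m p"

definition R_i :: "real \<Rightarrow> quat^2^2" where
  "R_i r = (1 / sqrt (1 + r\<^sup>2)) *\<^sub>R qmat2 1 (r *\<^sub>R quat_i) (- (r *\<^sub>R quat_i)) (- 1)"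

end

theory Submission
  imports Defs
begin

text \<open>The automorphism \<open>\<psi>\<^sub>1\<close> fixes \<open>\<langle>\<zeta>\<rangle>\<close> pointwise and negates \<open>\<langle>\<zeta>\<rangle> j\<close>, so every element of
  \<open>G(D\<^sub>m, 1, \<psi>\<^sub>1)\<close> is one of \<open>diag(1, 1)\<close>, \<open>diag(j, -j)\<close>, times possibly the swap, multiplied from
  the left by a power of \<open>\<zeta>\<close>. The reflections \<open>R\<^bsub>r,i\<^esub>\<close> have entries in \<open>\<complex>\<close>, hence commute with
  \<open>\<zeta>\<close>; they also commute with \<open>diag(j, -j)\<close> and anticommute with the swap, and \<open>-1\<close> is a
  power of \<open>\<zeta>\<close>. Every \<open>x\<close> in \<open>C\<^bsub>2m\<^esub>\<close> satisfies \<open>x\<inverse> = cnj x\<close>, so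
  the relation \<open>\<phi>(C\<^sub>2 x) = C\<^sub>2 y\<close> says \<open>x y = \<plusminus>1\<close>, and \<open>G(C\<^bsub>2m\<^esub>, C\<^sub>2, \<phi>)\<close> is equal to \<open>ST(2m, m, 2)\<close>.\<close>

section \<open>Coordinates of two-by-two matrices and the embedding of \<complex> into the
  quaternions\<close>

lemma qmat2_nth [simp]:
  "qmat2 a b c d $ 1 $ 1 = a" "qmat2 a b c d $ 1 $ 2 = b"
  "qmat2 a b c d $ 2 $ 1 = c" "qmat2 a b c d $ 2 $ 2 = d"
  by (simp_all add: qmat2_def)

lemma qmat2_eq_iff [simp]:
  "qmat2 a b c d = qmat2 a' b' c' d' \<longleftrightarrow> a = a' \<and> b = b' \<and> c = c' \<and> d = d'"
  by (auto simp: vec_eq_iff forall_2)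

lemma qmat2_mult:
  fixes a :: "'a::semiring_1"
  shows "qmat2 a b c d ** qmat2 a' b' c' d' =
    qmat2 (a * a' + b * c') (a * b' + b * d') (c * a' + d * c') (c * b' + d * d')"
  by (simp add: vec_eq_iff forall_2 matrix_matrix_mult_def sum_2)

lemma conj_transpose_qmat2:
  "conj_transpose (qmat2 a b c d) = qmat2 (qcnj a) (qcnj c) (qcnj b) (qcnj d)"
  by (simp add: vec_eq_iff forall_2 conj_transpose_def)

lemma scaleR_qmat2:
  fixes a :: quat
  shows "r *\<^sub>R qmat2 a b c d = qmat2 (r *\<^sub>R a) (r *\<^sub>R b) (r *\<^sub>R c) (r *\<^sub>R d)"
  by (simp add: vec_eq_iff forall_2)

lemma mat_1_qmat2: "mat 1 = qmat2 1 0 0 (1::quat)"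
  by (simp add: vec_eq_iff forall_2 mat_def)

lemma qcnj_scaleR: "qcnj (r *\<^sub>R p) = r *\<^sub>R qcnj p"
  by (simp add: quat_eq_iff)

lemma quat_numeral_sel [simp]:
  "qRe (numeral n) = numeral n" "qI (numeral n) = 0" "qJ (numeral n) = 0" "qK (numeral n) = 0"
  unfolding of_real_numeral[symmetric, where 'a = quat] of_real_def by simp_all

lemma quat_i_sel [simp]: "qRe quat_i = 0" "qI quat_i = 1" "qJ quat_i = 0" "qK quat_i = 0"
  by (simp_all add: quat_i_def)

lemma quat_j_sel [simp]: "qRe quat_j = 0" "qI quat_j = 0" "qJ quat_j = 1" "qK quat_j = 0"
  by (simp_all add: quat_j_def)

lemma quat_of_complex_sel [simp]:
  "qRe (quat_of_complex z) = Re z" "qI (quat_of_complex z) = Im z"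
  "qJ (quat_of_complex z) = 0" "qK (quat_of_complex z) = 0"
  by (simp_all add: quat_of_complex_def)

lemma quat_of_complex_simps [simp]:
  "quat_of_complex 0 = 0" "quat_of_complex 1 = 1"
  "quat_of_complex (- z) = - quat_of_complex z"
  "qcnj (quat_of_complex z) = quat_of_complex (cnj z)"
  by (simp_all add: quat_eq_iff)

lemma quat_of_complex_mult:
  "quat_of_complex (z * w) = quat_of_complex z * quat_of_complex w"
  by (simp add: quat_eq_iff quat_sel_times)

lemma quat_of_complex_eq_iff [simp]: "quat_of_complex z = quat_of_complex w \<longleftrightarrow> z = w"
  by (auto simp: quat_eq_iff complex_eq_iff)

lemma qnorm_quat_of_complex [simp]: "qnorm (quat_of_complex z) = cmod z"
  by (simp add: qnorm_def cmod_def)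

lemma qnorm_quat_j [simp]: "qnorm quat_j = 1"
  by (simp add: qnorm_def)

lemma qzeta_eq_cis: "qzeta n = quat_of_complex (cis (2 * pi / real n))"
  by (simp add: qzeta_def quat_of_complex_def)

lemma S3_simps [simp]:
  "carrier S3 = {q. qnorm q = 1}" "x \<otimes>\<^bsub>S3\<^esub> y = x * y" "\<one>\<^bsub>S3\<^esub> = 1"
  by (simp_all add: S3_def)

lemma inv_S3: "qnorm x = 1 \<Longrightarrow> inv\<^bsub>S3\<^esub> x = qcnj x"
  by (rule group.inv_equality[OF group_S3]) (simp_all add: qcnj_mult_self)

section \<open>Roots of unity and the elements of \<open>cyclic_C\<close> and
  \<open>bindihedral_D\<close>\<close>

lemma cis_root_of_unity: "n > 0 \<Longrightarrow> cis (2 * pi / real n) ^ n = 1"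
  by (simp add: Complex.DeMoivre)

text \<open>Expressing a root as a power of one generator allows membership in a generated group,
  and values of a homomorphism on it, to be obtained by induction on the exponent.\<close>

lemma root_of_unity_eq_cis_power:
  assumes "n > 0" "z ^ n = 1"
  shows "\<exists>k. z = cis (2 * pi / real n) ^ k"
proof -
  obtain k where "z = cis (2 * pi * real k / real n)"
    using bij_betw_imp_surj_on[OF Complex.bij_betw_roots_unity[OF assms(1)]] assms(2) by blast
  then have "z = cis (2 * pi / real n) ^ k"
    unfolding Complex.DeMoivre by (simp add: mult_ac)
  then show ?thesis ..
qed

lemma cmod_root_of_unity:
  assumes "n > 0" "z ^ n = 1"
  shows "cmod z = 1"
proof (rule power_eq_imp_eq_base)
  show "cmod z ^ n = 1 ^ n"
    unfolding norm_power[symmetric] assms(2) by simp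
qed (use assms in auto)

text \<open>The embedded roots form a subgroup containing the generator, and each of them is a power
  of the generator. For \<open>n = 0\<close> the equation \<open>z ^ n = 1\<close> would hold for
  every \<open>z\<close>.\<close>

lemma cyclic_C_eq:
  assumes "n > 0"
  shows "cyclic_C n = quat_of_complex ` {z. z ^ n = 1}"
proof
  interpret group S3 by (rule group_S3)
  have "subgroup (quat_of_complex ` {z. z ^ n = 1}) S3"
  proof (rule subgroupI)
    show "quat_of_complex ` {z. z ^ n = 1} \<subseteq> carrier S3"
      using assms by (auto simp: cmod_root_of_unity[of n])
    show "quat_of_complex ` {z. z ^ n = 1} \<noteq> {}"
      by (auto intro: exI[of _ 1])
  next
    fix a assume "a \<in> quat_of_complex ` {z. z ^ n = 1}"
    then obtain z where z: "z ^ n = 1" "a = quat_of_complex z" by blast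
    then have "inv\<^bsub>S3\<^esub> a = quat_of_complex (cnj z)"
      using cmod_root_of_unity[OF assms z(1)] by (simp add: inv_S3)
    moreover have "cnj z ^ n = 1"
      using z(1) by (metis complex_cnj_one complex_cnj_power)
    ultimately show "inv\<^bsub>S3\<^esub> a \<in> quat_of_complex ` {z. z ^ n = 1}"
      by simp
  next
    fix a b assume "a \<in> quat_of_complex ` {z. z ^ n = 1}" "b \<in> quat_of_complex ` {z. z ^ n = 1}"
    then obtain z w where "z ^ n = 1" "w ^ n = 1" "a = quat_of_complex z" "b = quat_of_complex w"
      by blast
    then have "a \<otimes>\<^bsub>S3\<^esub> b = quat_of_complex (z * w)" "(z * w) ^ n = 1"
      by (simp_all add: quat_of_complex_mult power_mult_distrib)
    then show "a \<otimes>\<^bsub>S3\<^esub> b \<in> quat_of_complex ` {z. z ^ n = 1}"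
      by simp
  qed
  then show "cyclic_C n \<subseteq> quat_of_complex ` {z. z ^ n = 1}"
    unfolding cyclic_C_def using assms
    by (intro generate_subgroup_incl) (auto simp: qzeta_eq_cis cis_root_of_unity)
  have pow: "quat_of_complex (cis (2 * pi / real n) ^ k) \<in> cyclic_C n" for k
  proof (induction k)
    case 0
    show ?case using generate.one[of S3] by (simp add: cyclic_C_def)
  next
    case (Suc k)
    have "qzeta n \<in> cyclic_C n" by (simp add: cyclic_C_def generate.incl)
    from generate.eng[OF this[unfolded cyclic_C_def] Suc[unfolded cyclic_C_def]] show ?case
      by (simp add: cyclic_C_def qzeta_eq_cis quat_of_complex_mult)
  qed
  show "quat_of_complex ` {z. z ^ n = 1} \<subseteq> cyclic_C n"
  proof safe
    fix z :: complex assume "z ^ n = 1"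
    with root_of_unity_eq_cis_power[OF assms] obtain k where "z = cis (2 * pi / real n) ^ k"
      by blast
    then show "quat_of_complex z \<in> cyclic_C n" using pow by simp
  qed
qed

lemma cyclic_C_2: "cyclic_C 2 = {1, -1}"
proof -
  have "{z::complex. z ^ 2 = 1} = {1, -1}"
    unfolding power2_eq_1_iff by blast
  then have "cyclic_C 2 = quat_of_complex ` {1, -1}"
    using cyclic_C_eq[of 2] by (simp only: zero_less_numeral)
  then show ?thesis
    by (simp only: image_insert image_empty quat_of_complex_simps)
qed

text \<open>Since \<open>j z = (cnj z) j\<close> for complex \<open>z\<close> and
  \<open>j * j = -1\<close>, at most one factor \<open>j\<close> survives in any product, and it can
  be moved to the right. The sign is absorbed because \<open>2 * m\<close> is even, so that -1 is a
  root of unity of this order.\<close>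

lemma bindihedral_D_eq:
  assumes "m > 0"
  shows "bindihedral_D m = cyclic_C (2 * m) \<union> (\<lambda>x. x * quat_j) ` cyclic_C (2 * m)"
    (is "_ = ?C \<union> ?J")
proof
  interpret group S3 by (rule group_S3)
  define U where "U = {z::complex. z ^ (2 * m) = 1}"
  have C: "?C = quat_of_complex ` U"
    unfolding U_def using assms by (intro cyclic_C_eq) simp
  have U: "1 \<in> U" "cis (2 * pi / real (2 * m)) \<in> U" "z \<in> U \<Longrightarrow> cmod z = 1"
    "z \<in> U \<Longrightarrow> cnj z \<in> U" "z \<in> U \<Longrightarrow> - z \<in> U" "z \<in> U \<Longrightarrow> w \<in> U \<Longrightarrow> z * w \<in> U" for z w
    using assms cis_root_of_unity[of "2 * m"] cmod_root_of_unity[of "2 * m"]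
    by (auto simp: U_def power_mult_distrib simp flip: complex_cnj_power)
  have inC: "quat_of_complex z \<in> ?C \<union> ?J" and inJ: "quat_of_complex z * quat_j \<in> ?C \<union> ?J"
    if "z \<in> U" for z
    using that by (auto simp: C)
  have elim: "\<exists>z\<in>U. x = quat_of_complex z \<or> x = quat_of_complex z * quat_j"
    if "x \<in> ?C \<union> ?J" for x
    using that by (auto simp: C)
  have "subgroup (?C \<union> ?J) S3"
  proof (rule subgroupI)
    show "?C \<union> ?J \<subseteq> carrier S3"
      by (auto simp: C U qnorm_mult)
    show "?C \<union> ?J \<noteq> {}"
      using inC[OF U(1)] by blast
  next
    fix a assume "a \<in> ?C \<union> ?J"
    from elim[OF this] obtain z where z: "z \<in> U"
      and a: "a = quat_of_complex z \<or> a = quat_of_complex z * quat_j" by blast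
    have "qcnj (quat_of_complex z * quat_j) = quat_of_complex (- z) * quat_j"
      by (simp add: quat_eq_iff quat_sel_times)
    with a z inC[of "cnj z"] inJ[of "- z"] show "inv\<^bsub>S3\<^esub> a \<in> ?C \<union> ?J"
      by (auto simp: inv_S3 U qnorm_mult)
  next
    fix a b assume "a \<in> ?C \<union> ?J" "b \<in> ?C \<union> ?J"
    with elim obtain z w where zw: "z \<in> U" "w \<in> U"
      and a: "a = quat_of_complex z \<or> a = quat_of_complex z * quat_j"
      and b: "b = quat_of_complex w \<or> b = quat_of_complex w * quat_j" by metis
    \<comment> \<open>Moving \<open>j\<close> to the right past \<open>w\<close> replaces
      \<open>w\<close> by its conjugate.\<close>
    have "quat_of_complex z * quat_of_complex w = quat_of_complex (z * w)"
      "quat_of_complex z * (quat_of_complex w * quat_j) = quat_of_complex (z * w) * quat_j"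
      "quat_of_complex z * quat_j * quat_of_complex w = quat_of_complex (z * cnj w) * quat_j"
      "quat_of_complex z * quat_j * (quat_of_complex w * quat_j) = quat_of_complex (- (z * cnj w))"
      by (simp_all add: quat_eq_iff quat_sel_times)
    then have "a * b \<in> {quat_of_complex (z * w), quat_of_complex (z * w) * quat_j,
        quat_of_complex (z * cnj w) * quat_j, quat_of_complex (- (z * cnj w))}"
      using a b by (elim disjE) simp_all
    moreover have "z * w \<in> U" "z * cnj w \<in> U" "- (z * cnj w) \<in> U"
      using zw by (simp_all add: U)
    note inC[OF this(1)] inJ[OF this(1)] inJ[OF this(2)] inC[OF this(3)]
    ultimately
    show "a \<otimes>\<^bsub>S3\<^esub> b \<in> ?C \<union> ?J" unfolding S3_simps
      by (elim insertE emptyE) (simp_all only:)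
  qed
  moreover have "{qzeta (2 * m), quat_j} \<subseteq> ?C \<union> ?J"
    using inC[OF U(2)] inJ[OF U(1)] unfolding qzeta_eq_cis by simp
  ultimately show "bindihedral_D m \<subseteq> ?C \<union> ?J"
    unfolding bindihedral_D_def by (rule generate_subgroup_incl[rotated])
  have "?C \<subseteq> bindihedral_D m"
    unfolding cyclic_C_def bindihedral_D_def by (rule mono_generate) simp
  moreover have "x * quat_j \<in> bindihedral_D m" if "x \<in> bindihedral_D m" for x
    using generate.eng[OF that[unfolded bindihedral_D_def] generate.incl[of quat_j]]
    by (simp add: bindihedral_D_def)
  ultimately show "?C \<union> ?J \<subseteq> bindihedral_D m" by blast
qed

section \<open>Values of the automorphism \<open>psi1\<close>\<close>

text \<open>The unique existence in \<open>psi1_ex1\<close> makes the definite description satisfy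
  its defining property; the inverse of the unit quaternion \<open>j\<close> is its conjugate
  \<open>- j\<close>.\<close>

lemma psi1_hom: "psi1 m \<in> hom (S3\<lparr>carrier := bindihedral_D m\<rparr>) (S3\<lparr>carrier := bindihedral_D m\<rparr>)"
  and psi1_qzeta: "psi1 m (qzeta (2 * m)) = qzeta (2 * m)"
  and psi1_quat_j: "psi1 m quat_j = - quat_j"
proof -
  have "inv\<^bsub>S3\<^esub> quat_j = - quat_j"
    by (simp add: inv_S3 quat_eq_iff)
  moreover have *: "psi1 m \<in> auto (S3\<lparr>carrier := bindihedral_D m\<rparr>) \<and>
      psi1 m (qzeta (2 * m)) = qzeta (2 * m) \<and> psi1 m quat_j = inv\<^bsub>S3\<^esub> quat_j"
    unfolding psi1_def by (rule theI'[OF psi1_ex1])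
  ultimately show "psi1 m quat_j = - quat_j"
    by (simp only:)
  show "psi1 m (qzeta (2 * m)) = qzeta (2 * m)"
    using * by (elim conjE)
  show "psi1 m \<in> hom (S3\<lparr>carrier := bindihedral_D m\<rparr>) (S3\<lparr>carrier := bindihedral_D m\<rparr>)"
    using conjunct1[OF *] unfolding auto_def by (rule IntD1)
qed

lemma psi1_mult:
  assumes "x \<in> bindihedral_D m" "y \<in> bindihedral_D m"
  shows "psi1 m (x * y) = psi1 m x * psi1 m y"
  using hom_mult[OF psi1_hom, of x m y] assms by simp

text \<open>A homomorphism that fixes the generator fixes all of its powers.\<close>

lemma psi1_cyclic_C:
  assumes "m > 0" "x \<in> cyclic_C (2 * m)"
  shows "psi1 m x = x"
proof -
  have D: "cyclic_C (2 * m) \<subseteq> bindihedral_D m"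
    using bindihedral_D_eq[OF assms(1)] by blast
  have Z: "qzeta (2 * m) \<in> cyclic_C (2 * m)"
    by (simp add: cyclic_C_def generate.incl)
  have one: "1 \<in> cyclic_C (2 * m)"
    using generate.one[of S3] by (simp add: cyclic_C_def)
  \<comment> \<open>The generator has norm 1, so left multiplication by its conjugate cancels it
    from \<open>qzeta (2 * m) * psi1 m 1 = qzeta (2 * m)\<close>.\<close>
  have psi_one: "psi1 m 1 = 1"
  proof -
    have "qzeta (2 * m) * psi1 m 1 = qzeta (2 * m) * 1"
      using psi1_mult[OF subsetD[OF D Z] subsetD[OF D one]] psi1_qzeta[of m] by simp
    then have "qcnj (qzeta (2 * m)) * (qzeta (2 * m) * psi1 m 1) = qcnj (qzeta (2 * m)) * qzeta (2 * m)"
      by simp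
    then show ?thesis
      unfolding mult.assoc[symmetric] qcnj_mult_self by (simp add: qzeta_eq_cis)
  qed
  have pow: "quat_of_complex (cis (2 * pi / real (2 * m)) ^ k) \<in> cyclic_C (2 * m) \<and>
    psi1 m (quat_of_complex (cis (2 * pi / real (2 * m)) ^ k)) =
      quat_of_complex (cis (2 * pi / real (2 * m)) ^ k)" for k
  proof (induction k)
    case 0
    show ?case using one psi_one by simp
  next
    case (Suc k)
    have "qzeta (2 * m) * quat_of_complex (cis (2 * pi / real (2 * m)) ^ k) \<in> cyclic_C (2 * m)"
      using generate.eng[OF Z[unfolded cyclic_C_def]] Suc by (simp add: cyclic_C_def)
    then show ?case
      using psi1_mult[OF subsetD[OF D Z] subsetD[OF D conjunct1[OF Suc]]] Suc psi1_qzeta[of m]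
      by (simp add: qzeta_eq_cis quat_of_complex_mult)
  qed
  obtain z where z: "z ^ (2 * m) = 1" "x = quat_of_complex z"
    using assms cyclic_C_eq[of "2 * m"] by auto
  then obtain k where "z = cis (2 * pi / real (2 * m)) ^ k"
    using root_of_unity_eq_cis_power[of "2 * m" z] assms(1) by auto
  with pow z show ?thesis by simp
qed

lemma psi1_cyclic_C_mult_quat_j:
  assumes "m > 0" "x \<in> cyclic_C (2 * m)"
  shows "psi1 m (x * quat_j) = - (x * quat_j)"
proof -
  have "quat_j \<in> bindihedral_D m"
    by (simp add: bindihedral_D_def generate.incl)
  with assms show ?thesis
    using psi1_mult[of x m quat_j] psi1_cyclic_C[of m x] bindihedral_D_eq[of m] psi1_quat_j[of m]
    by auto
qed

section \<open>Explicit elements of the two imprimitive groups\<close>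

text \<open>The second matrix is the first one multiplied by the swap from the right, so an
  imprimitive group is a union of such pairs over the admissible \<open>(x, y)\<close>.\<close>

definition diag_or_anti :: "quat \<Rightarrow> quat \<Rightarrow> (quat^2^2) set" where
  "diag_or_anti x y = {qmat2 x 0 0 y, qmat2 0 x y 0}"

lemma imprim_group_eq:
  "imprim_group K H \<phi> = (\<Union>x\<in>K. \<Union>y\<in>{y\<in>K. \<phi> (H #>\<^bsub>S3\<^esub> x) = H #>\<^bsub>S3\<^esub> y}. diag_or_anti x y)"
proof -
  have swap: "qmat2 x 0 0 y ** qmat2 0 1 1 0 = qmat2 0 x y 0" for x y :: quat
    by (simp add: qmat2_mult)
  have "(\<lambda>A. A ** qmat2 0 1 1 0) ` {qmat2 x 0 0 y | x y. P x y} = {qmat2 0 x y 0 | x y. P x y}"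
    for P :: "quat \<Rightarrow> quat \<Rightarrow> bool"
    by (auto simp: swap image_iff) (metis swap)
  then show ?thesis
    unfolding imprim_group_def diag_or_anti_def Let_def by auto
qed

text \<open>For trivial \<open>H\<close> the cosets are singletons, so the second entry is the image
  of the first under \<open>psi1\<close>: equal to it on the cyclic part, its negative on the coset
  of \<open>j\<close>.\<close>

lemma G_D_psi1_eq:
  assumes "m > 0"
  shows "G_D_psi1 m = (\<Union>x\<in>cyclic_C (2 * m). diag_or_anti x x \<union> diag_or_anti (x * quat_j) (- (x * quat_j)))"
proof -
  have m1: "-1 \<in> cyclic_C (2 * m)"
    using assms by (auto simp: cyclic_C_eq image_iff intro!: exI[of _ "-1"])
  have minus: "- x \<in> cyclic_C (2 * m)" if "x \<in> cyclic_C (2 * m)" for x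
    using generate.eng[of "-1" S3 "{qzeta (2 * m)}" x] m1 that by (simp add: cyclic_C_def)
  \<comment> \<open>Closure under \<open>psi1\<close> makes the membership condition on the second
    entry automatic, which leaves a union over the first entry alone.\<close>
  have "psi1 m x \<in> bindihedral_D m" if "x \<in> bindihedral_D m" for x
    using hom_in_carrier[OF psi1_hom] that by simp
  then have "G_D_psi1 m = (\<Union>x\<in>bindihedral_D m. diag_or_anti x (psi1 m x))"
    unfolding G_D_psi1_def imprim_group_eq by (auto simp: r_coset_def)
  then show ?thesis
    using assms by (auto simp: bindihedral_D_eq psi1_cyclic_C psi1_cyclic_C_mult_quat_j)
qed

text \<open>The cosets of \<open>cyclic_C 2\<close> are the pairs \<open>{x, - x}\<close>, and
  inversion of unit quaternions is conjugation; hence the second entry can only be the conjugate of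
  the first up to sign.\<close>

lemma G_C_inv_eq:
  assumes "m > 0"
  shows "G_C_inv m = (\<Union>x\<in>cyclic_C (2 * m). diag_or_anti x (qcnj x) \<union> diag_or_anti x (- qcnj x))"
proof -
  define C where "C = cyclic_C (2 * m)"
  define S where "S = S3\<lparr>carrier := C\<rparr>"
  interpret S3: group S3 by (rule group_S3)
  have Ceq: "C = quat_of_complex ` {z. z ^ (2 * m) = 1}"
    using assms by (simp add: C_def cyclic_C_eq)
  have norm: "qnorm x = 1" if "x \<in> C" for x
    using that assms cmod_root_of_unity[of "2 * m"] by (auto simp: Ceq)
  have sub: "subgroup C S3"
    unfolding C_def cyclic_C_def
    by (rule S3.generate_is_subgroup) (simp add: qzeta_eq_cis)
  have sub2: "subgroup (cyclic_C 2) S3"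
    unfolding cyclic_C_def
    by (rule S3.generate_is_subgroup) (simp add: qzeta_eq_cis)
  have m1: "-1 \<in> C"
    by (auto simp: Ceq image_iff intro!: exI[of _ "-1"])
  have grp: "group S"
    unfolding S_def by (rule S3.subgroup_imp_group[OF sub])
  \<comment> \<open>Commutativity gives the normality of \<open>cyclic_C 2\<close>, on which the
    inverse of a coset in the quotient depends.\<close>
  interpret S: comm_group S
  proof (rule group.group_comm_groupI[OF grp])
    fix x y assume "x \<in> carrier S" "y \<in> carrier S"
    then show "x \<otimes>\<^bsub>S\<^esub> y = y \<otimes>\<^bsub>S\<^esub> x"
      by (auto simp: S_def Ceq mult.commute simp flip: quat_of_complex_mult)
  qed
  have "subgroup (cyclic_C 2) S"
    unfolding S_def
    by (rule S3.subgroup_incl[OF sub2 sub]) (use m1 subgroup.one_closed[OF sub] in \<open>auto simp: cyclic_C_2\<close>)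
  then interpret N: normal "cyclic_C 2" S
    by (rule S.subgroup_imp_normal)
  \<comment> \<open>\<open>imprim_group\<close> forms cosets in \<open>S3\<close>, the quotient
    forms them in \<open>S\<close>; computing both identifies the two.\<close>
  have coset: "cyclic_C 2 #>\<^bsub>S3\<^esub> x = {x, - x}" "cyclic_C 2 #>\<^bsub>S\<^esub> x = {x, - x}" for x
    by (auto simp: r_coset_def cyclic_C_2 S_def)
  have qc: "qcnj x \<in> C" if "x \<in> C" for x
    using subgroup.m_inv_closed[OF sub that] norm[OF that] by (simp add: inv_S3)
  have minus: "- x \<in> C" if "x \<in> C" for x
    using subgroup.m_closed[OF sub m1 that] by simp
  have inv: "inv\<^bsub>S Mod cyclic_C 2\<^esub> (cyclic_C 2 #>\<^bsub>S3\<^esub> x) = {qcnj x, - qcnj x}" if "x \<in> C" for x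
  proof -
    have xS: "x \<in> carrier S" using that by (simp add: S_def)
    have "inv\<^bsub>S\<^esub> x = qcnj x"
      by (rule S.inv_equality) (use that qc norm in \<open>auto simp: S_def qcnj_mult_self\<close>)
    moreover have "cyclic_C 2 #>\<^bsub>S\<^esub> x \<in> carrier (S Mod cyclic_C 2)"
      using xS by (auto simp: carrier_FactGroup)
    ultimately show ?thesis
      using N.inv_FactGroup[of "cyclic_C 2 #>\<^bsub>S\<^esub> x"] N.rcos_inv[OF xS] by (simp add: coset)
  qed
  have "{y \<in> C. inv\<^bsub>S Mod cyclic_C 2\<^esub> (cyclic_C 2 #>\<^bsub>S3\<^esub> x) = cyclic_C 2 #>\<^bsub>S3\<^esub> y} = {qcnj x, - qcnj x}"
    if "x \<in> C" for x
    unfolding inv[OF that] unfolding coset using qc[OF that] minus[of "qcnj x"]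
    by (auto simp: doubleton_eq_iff)
  then show ?thesis
    unfolding G_C_inv_def imprim_group_eq C_def[symmetric] S_def[symmetric] by simp
qed

section \<open>The Shephard-Todd group as an imprimitive quaternionic group\<close>

text \<open>A monomial matrix of size two is diagonal or antidiagonal, and in either case the
  product over the non-zero positions has just two factors.\<close>

lemma shephard_todd_eq:
  "shephard_todd n p = {qmat2 a 0 0 b | a b. a \<noteq> 0 \<and> b \<noteq> 0 \<and> a ^ n = 1 \<and> b ^ n = 1 \<and> (a * b) ^ (n div p) = 1}
     \<union> {qmat2 0 a b 0 | a b. a \<noteq> 0 \<and> b \<noteq> 0 \<and> a ^ n = 1 \<and> b ^ n = 1 \<and> (a * b) ^ (n div p) = 1}"
  (is "_ = ?D \<union> ?A")
proof
  have eq: "A = qmat2 (A $ 1 $ 1) (A $ 1 $ 2) (A $ 2 $ 1) (A $ 2 $ 2)" for A :: "complex^2^2"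
    by (simp add: vec_eq_iff forall_2)
  have diag: "{(i, j). qmat2 a 0 0 b $ i $ j \<noteq> 0} = {(1, 1), (2, 2)}" if "a \<noteq> 0" "b \<noteq> 0" for a b :: complex
    using that exhaust_2 by (auto simp: set_eq_iff forall_2)
  have anti: "{(i, j). qmat2 0 a b 0 $ i $ j \<noteq> 0} = {(1, 2), (2, 1)}" if "a \<noteq> 0" "b \<noteq> 0" for a b :: complex
    using that exhaust_2 by (auto simp: set_eq_iff forall_2)
  \<comment> \<open>Over two indices unique existence is exclusive or, written as inequality of
    truth values.\<close>
  have ex1: "(\<exists>!b::2. P b) \<longleftrightarrow> P 1 \<noteq> P 2" for P
  proof -
    have "(\<exists>b::2. Q b) \<longleftrightarrow> Q 1 \<or> Q 2" for Q
      by (metis exhaust_2)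
    then show ?thesis by (auto simp: Ex1_def forall_2)
  qed
  show "shephard_todd n p \<subseteq> ?D \<union> ?A"
  proof
    fix A assume A: "A \<in> shephard_todd n p"
    obtain a b c d where abcd: "A = qmat2 a b c d" using eq by blast
    from A have "(a \<noteq> 0 \<and> d \<noteq> 0 \<and> b = 0 \<and> c = 0) \<or> (a = 0 \<and> d = 0 \<and> b \<noteq> 0 \<and> c \<noteq> 0)"
      by (auto simp: shephard_todd_def ex1 forall_2 abcd)
    with A show "A \<in> ?D \<union> ?A"
      by (elim disjE) (auto simp: shephard_todd_def abcd diag anti forall_2)
  qed
  show "?D \<union> ?A \<subseteq> shephard_todd n p"
    by (auto simp: shephard_todd_def diag anti forall_2 ex1)
qed

text \<open>Here the exponent \<open>2 * m div m\<close> is 2, so the product condition reads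
  \<open>(a * b)\<^sup>2 = 1\<close>. As \<open>a\<close> has modulus 1, this means that
  \<open>b\<close> is \<open>cnj a\<close> or \<open>- cnj a\<close>.\<close>

lemma ST_eq_G_C_inv:
  assumes "m > 0"
  shows "ST (2 * m) m = G_C_inv m"
proof -
  define U where "U = {z::complex. z ^ (2 * m) = 1}"
  have C: "cyclic_C (2 * m) = quat_of_complex ` U"
    using assms by (simp add: U_def cyclic_C_eq)
  have nz: "z \<noteq> 0" and inv: "z * cnj z = 1" and cnj: "cnj z \<in> U" and minus: "- z \<in> U" if "z \<in> U" for z
  proof -
    have "cmod z = 1" using that assms cmod_root_of_unity[of "2 * m" z] by (simp add: U_def)
    then show "z * cnj z = 1" by (simp add: complex_norm_square[symmetric])
    then show "z \<noteq> 0" by auto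
  qed (use that in \<open>auto simp: U_def simp flip: complex_cnj_power\<close>)
  have iff: "b \<in> U \<and> (a * b)\<^sup>2 = 1 \<longleftrightarrow> b = cnj a \<or> b = - cnj a" if "a \<in> U" for a b
  proof -
    \<comment> \<open>Writing 1 as \<open>a * cnj a\<close> allows \<open>a\<close> to be
      cancelled.\<close>
    have "(a * b)\<^sup>2 = 1 \<longleftrightarrow> a * b = a * cnj a \<or> a * b = a * (- cnj a)"
      using inv[OF that] by (simp add: power2_eq_1_iff)
    also have "\<dots> \<longleftrightarrow> b = cnj a \<or> b = - cnj a"
      using nz[OF that] by (simp only: mult_cancel_left) simp
    finally show ?thesis using cnj[OF that] minus[of "cnj a"] by auto
  qed
  have map: "(\<chi> i j. quat_of_complex (qmat2 a b c d $ i $ j)) =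
      qmat2 (quat_of_complex a) (quat_of_complex b) (quat_of_complex c) (quat_of_complex d)" for a b c d
    by (simp add: vec_eq_iff forall_2)
  have "shephard_todd (2 * m) m = (\<Union>a\<in>U. \<Union>b\<in>{b. b \<in> U \<and> (a * b)\<^sup>2 = 1}. {qmat2 a 0 0 b, qmat2 0 a b 0})"
    using assms nz by (auto simp: shephard_todd_eq U_def)
  also have "\<dots> = (\<Union>a\<in>U. \<Union>b\<in>{cnj a, - cnj a}. {qmat2 a 0 0 b, qmat2 0 a b 0})"
    by (intro SUP_cong refl) (use iff in auto)
  finally show ?thesis
    unfolding ST_def G_C_inv_eq[OF assms] C
    by (simp add: image_UN image_Un map diag_or_anti_def)
qed

section \<open>Conjugation of subsets in the unitary group\<close>

lemma U2H_simps [simp]: "A \<otimes>\<^bsub>U2H\<^esub> B = A ** B" "\<one>\<^bsub>U2H\<^esub> = mat 1"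
  by (simp_all add: U2H_def)

lemma inv_U2H: "g \<in> carrier U2H \<Longrightarrow> inv\<^bsub>U2H\<^esub> g = conj_transpose g"
  using U2H_left_inverse
  by (intro group.inv_equality[OF group_U2H]) (auto simp: U2H_def)

text \<open>Both \<open>conjugate_in\<close> and \<open>normalizer\<close> are phrased with cosets;
  this turns them into images under an explicit map.\<close>

lemma conjugate_set_U2H:
  assumes "g \<in> carrier U2H"
  shows "g <#\<^bsub>U2H\<^esub> A #>\<^bsub>U2H\<^esub> (inv\<^bsub>U2H\<^esub> g) = (\<lambda>a. g ** a ** conj_transpose g) ` A"
  by (auto simp: l_coset_def r_coset_def inv_U2H[OF assms])

lemma diag_or_anti_subset_U2H:
  assumes "qnorm x = 1" "qnorm y = 1"
  shows "diag_or_anti x y \<subseteq> carrier U2H"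
  using assms
  by (simp add: diag_or_anti_def U2H_def conj_transpose_qmat2 qmat2_mult mat_1_qmat2 mult_qcnj)

text \<open>Closure under negation comes from the even exponent \<open>2 * m\<close>. The vanishing
  coordinates express that \<open>x\<close> is complex, the form in which the matrix calculations
  below use it.\<close>

lemma cyclic_C_double:
  assumes "m > 0" "x \<in> cyclic_C (2 * m)"
  shows "- x \<in> cyclic_C (2 * m)" "qJ x = 0" "qK x = 0" "qnorm x = 1"
proof -
  have C: "cyclic_C (2 * m) = quat_of_complex ` {z. z ^ (2 * m) = 1}"
    using assms(1) by (intro cyclic_C_eq) simp
  then obtain z where z: "x = quat_of_complex z" "z ^ (2 * m) = 1"
    using assms(2) by blast
  from z(2) have "(- z) ^ (2 * m) = 1" by simp
  then have "quat_of_complex (- z) \<in> cyclic_C (2 * m)"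
    unfolding C by blast
  then show "- x \<in> cyclic_C (2 * m)" by (simp add: z)
  show "qnorm x = 1" using cmod_root_of_unity[OF _ z(2)] assms(1) by (simp add: z(1))
qed (use assms cyclic_C_eq[of "2 * m"] in auto)

lemma G_D_psi1_subset_U2H:
  assumes "m > 0"
  shows "G_D_psi1 m \<subseteq> carrier U2H"
  unfolding G_D_psi1_eq[OF assms] using cyclic_C_double(4)[OF assms]
  by (intro UN_least Un_least diag_or_anti_subset_U2H) (simp_all add: qnorm_mult)

lemma G_C_inv_subset_U2H:
  assumes "m > 0"
  shows "G_C_inv m \<subseteq> carrier U2H"
  unfolding G_C_inv_eq[OF assms] using cyclic_C_double(4)[OF assms]
  by (intro UN_least Un_least diag_or_anti_subset_U2H) simp_all

lemma conjugate_in_U2H_refl: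
  assumes "A \<subseteq> carrier U2H"
  shows "conjugate_in U2H A A"
proof -
  interpret group U2H by (rule group_U2H)
  have "\<one>\<^bsub>U2H\<^esub> <#\<^bsub>U2H\<^esub> A #>\<^bsub>U2H\<^esub> inv\<^bsub>U2H\<^esub> \<one>\<^bsub>U2H\<^esub> = A"
    using assms by (simp only: lcos_mult_one coset_mult_one inv_one)
  then show ?thesis
    unfolding conjugate_in_def using one_closed by metis
qed

section \<open>Conjugating \<open>G_D_psi1\<close> onto \<open>G_C_inv\<close>\<close>

lemma conj_transpose_scaleR:
  fixes A :: "quat^2^2"
  shows "conj_transpose (s *\<^sub>R A) = s *\<^sub>R conj_transpose A"
  by (simp add: vec_eq_iff conj_transpose_def qcnj_scaleR)

text \<open>Collects the two normalising factors of a conjugation into one scalar, so that the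
  square roots disappear before entries are compared.\<close>

lemma scaleR_mult_mult_scaleR:
  fixes A B C :: "quat^2^2"
  shows "(s *\<^sub>R A) ** B ** (t *\<^sub>R C) = (s * t) *\<^sub>R (A ** B ** C)"
  by (simp add: vec_eq_iff matrix_matrix_mult_def sum_2 algebra_simps)

text \<open>Conjugation by \<open>diag(1,i)\<close> turns the elements \<open>diag(\<xi>, \<psi>\<^sub>1(\<xi>))\<close> into scalar matrices and the
  swap into a complex involution. The matrix below is that conjugation, followed by a
  diagonalisation of the involution and by conjugation with \<open>diag(1,j)\<close>, which
  turns the scalar \<open>\<zeta>\<close> into \<open>diag(\<zeta>, \<zeta>\<inverse>)\<close>.\<close>

definition conjugator :: "quat^2^2" where
  "conjugator = (1 / sqrt 2) *\<^sub>R qmat2 1 1 quat_j (- quat_j)"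

lemma conjugator_conj:
  "conjugator ** A ** conj_transpose conjugator =
    (1 / 2) *\<^sub>R (qmat2 1 1 quat_j (- quat_j) ** A ** qmat2 1 (- quat_j) 1 quat_j)"
proof -
  have "qcnj quat_j = - quat_j" "qcnj (- quat_j) = quat_j"
    by (simp_all add: quat_eq_iff)
  then show ?thesis
    by (simp add: conjugator_def conj_transpose_scaleR conj_transpose_qmat2 scaleR_mult_mult_scaleR)
qed

lemma conjugator_in_U2H: "conjugator \<in> carrier U2H"
proof -
  \<comment> \<open>Unitarity is the conjugation formula applied to the identity matrix.\<close>
  have "conjugator ** mat 1 ** conj_transpose conjugator = mat 1"
    unfolding conjugator_conj
    by (simp add: mat_1_qmat2 qmat2_mult scaleR_qmat2 quat_eq_iff quat_sel_times)
  then show ?thesis by (simp add: U2H_def)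
qed

text \<open>The rows \<open>(1, 1)\<close> and \<open>(j, - j)\<close> are left eigenvectors of the
  swap for 1 and -1, so the swap becomes \<open>diag(1, -1)\<close>. For complex \<open>x\<close>,
  \<open>j x (- j)\<close> is the conjugate of \<open>x\<close>, which produces the conjugates in
  the second row.\<close>

lemma conjugator_conj_diag_or_anti:
  assumes "qJ x = 0" "qK x = 0"
  shows "conjugator ** qmat2 x 0 0 x ** conj_transpose conjugator = qmat2 x 0 0 (qcnj x)"
    and "conjugator ** qmat2 0 x x 0 ** conj_transpose conjugator = qmat2 x 0 0 (- qcnj x)"
    and "conjugator ** qmat2 (x * quat_j) 0 0 (- (x * quat_j)) ** conj_transpose conjugator =
      qmat2 0 x (- qcnj x) 0"
    and "conjugator ** qmat2 0 (x * quat_j) (- (x * quat_j)) 0 ** conj_transpose conjugator =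
      qmat2 0 (- x) (- qcnj x) 0"
  unfolding conjugator_conj
  by (simp_all only: qmat2_mult scaleR_qmat2 qmat2_eq_iff)
    (simp_all add: assms quat_eq_iff quat_sel_times)

lemma conjugate_G_D_psi1_G_C_inv:
  assumes "m > 0"
  shows "conjugate_in U2H (G_D_psi1 m) (G_C_inv m)"
proof -
  have "G_C_inv m = (\<lambda>A. conjugator ** A ** conj_transpose conjugator) ` G_D_psi1 m"
    (is "_ = ?G")
  proof -
    have G: "?G = (\<Union>x\<in>cyclic_C (2 * m). {qmat2 x 0 0 (qcnj x), qmat2 x 0 0 (- qcnj x)} \<union>
        {qmat2 0 x (- qcnj x) 0, qmat2 0 (- x) (- qcnj x) 0})"
      unfolding G_D_psi1_eq[OF assms] image_UN image_Un
      by (intro SUP_cong refl)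
        (simp add: diag_or_anti_def conjugator_conj_diag_or_anti cyclic_C_double[OF assms])
    have qcnj_minus: "qcnj (- x) = - qcnj x" for x
      by (simp add: quat_eq_iff)
    note minus = cyclic_C_double(1)[OF assms]
    show ?thesis
    proof
      show "G_C_inv m \<subseteq> ?G"
      proof
        fix A assume "A \<in> G_C_inv m"
        then obtain x where x: "x \<in> cyclic_C (2 * m)"
          and A: "A \<in> {qmat2 x 0 0 (qcnj x), qmat2 x 0 0 (- qcnj x), qmat2 0 x (- qcnj x) 0}
            \<or> A = qmat2 0 x (qcnj x) 0"
          unfolding G_C_inv_eq[OF assms] diag_or_anti_def by blast
        \<comment> \<open>Three of the four families match with the same \<open>x\<close>; the
          remaining antidiagonal one is reached with the index \<open>- x\<close>.\<close>
        from A show "A \<in> ?G"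
        proof
          assume "A = qmat2 0 x (qcnj x) 0"
          then show ?thesis
            unfolding G by (intro UN_I[OF minus[OF x]]) (simp add: qcnj_minus)
        qed (use x G in blast)
      qed
      show "?G \<subseteq> G_C_inv m"
      proof
        fix A assume "A \<in> ?G"
        then obtain x where x: "x \<in> cyclic_C (2 * m)"
          and A: "A \<in> {qmat2 x 0 0 (qcnj x), qmat2 x 0 0 (- qcnj x), qmat2 0 x (- qcnj x) 0}
            \<or> A = qmat2 0 (- x) (- qcnj x) 0"
          unfolding G by blast
        from A show "A \<in> G_C_inv m"
        proof
          assume "A = qmat2 0 (- x) (- qcnj x) 0"
          then show ?thesis
            unfolding G_C_inv_eq[OF assms] diag_or_anti_def
            by (intro UN_I[OF minus[OF x]]) (simp add: qcnj_minus)
        qed (use x in \<open>unfold G_C_inv_eq[OF assms] diag_or_anti_def, blast\<close>)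
      qed
    qed
  qed
  then show ?thesis
    unfolding conjugate_in_def using conjugator_in_U2H conjugate_set_U2H by metis
qed

section \<open>The matrices \<open>R_i r\<close>: normalising \<open>G_D_psi1\<close> and being
  reflections\<close>

lemma sqrt_1_plus_square: "1 + r\<^sup>2 \<noteq> 0" "sqrt (1 + r\<^sup>2) * sqrt (1 + r\<^sup>2) = 1 + r\<^sup>2" "sqrt (1 + r\<^sup>2) > 0"
  for r :: real
proof -
  have "1 + r\<^sup>2 > 0" by (rule add_pos_nonneg) simp_all
  then show "1 + r\<^sup>2 \<noteq> 0" "sqrt (1 + r\<^sup>2) * sqrt (1 + r\<^sup>2) = 1 + r\<^sup>2" "sqrt (1 + r\<^sup>2) > 0"
    by simp_all
qed

text \<open>Quaternion conjugation changes the signs of the two off-diagonal entries, and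
  transposition exchanges them back.\<close>

lemma conj_transpose_R_i: "conj_transpose (R_i r) = R_i r"
  unfolding R_i_def conj_transpose_scaleR conj_transpose_qmat2
  by (intro arg_cong[where f = "scaleR _"]) (simp add: quat_eq_iff)

text \<open>Clearing both square roots at once leaves entrywise identities that are polynomial in
  \<open>r\<close>.\<close>

lemma R_i_conj:
  assumes "qmat2 1 (r *\<^sub>R quat_i) (- (r *\<^sub>R quat_i)) (- 1) ** A **
    qmat2 1 (r *\<^sub>R quat_i) (- (r *\<^sub>R quat_i)) (- 1) = (1 + r\<^sup>2) *\<^sub>R B"
  shows "R_i r ** A ** R_i r = B"
  unfolding R_i_def scaleR_mult_mult_scaleR assms using sqrt_1_plus_square[of r] by simp

lemma R_i_mult_self: "R_i r ** R_i r = mat 1"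
proof -
  have "R_i r ** mat 1 ** R_i r = mat 1"
    by (rule R_i_conj)
      (simp add: mat_1_qmat2 qmat2_mult scaleR_qmat2 quat_eq_iff quat_sel_times power2_eq_square)
  then show ?thesis by simp
qed

lemma R_i_in_U2H: "R_i r \<in> carrier U2H"
  by (simp add: U2H_def conj_transpose_R_i R_i_mult_self)

text \<open>Complex \<open>x\<close> commutes with \<open>i\<close>. In \<open>diag(j, - j)\<close>
  the sign from \<open>j i = - i j\<close> is offset by the opposite signs of the diagonal
  entries.\<close>

lemma R_i_conj_diag_or_anti:
  assumes "qJ x = 0" "qK x = 0"
  shows "R_i r ** qmat2 x 0 0 x ** R_i r = qmat2 x 0 0 x"
    and "R_i r ** qmat2 0 x x 0 ** R_i r = qmat2 0 (- x) (- x) 0"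
    and "R_i r ** qmat2 (x * quat_j) 0 0 (- (x * quat_j)) ** R_i r =
      qmat2 (x * quat_j) 0 0 (- (x * quat_j))"
    and "R_i r ** qmat2 0 (x * quat_j) (- (x * quat_j)) 0 ** R_i r =
      qmat2 0 (- (x * quat_j)) (x * quat_j) 0"
  by (rule R_i_conj; simp add: assms qmat2_mult scaleR_qmat2 quat_eq_iff quat_sel_times
      power2_eq_square algebra_simps)+

lemma R_i_in_normalizer:
  assumes "m > 0"
  shows "R_i r \<in> normalizer U2H (G_D_psi1 m)"
proof -
  let ?f = "\<lambda>A. R_i r ** A ** conj_transpose (R_i r)"
  have closed: "?f A \<in> G_D_psi1 m" if "A \<in> G_D_psi1 m" for A
  proof -
    from that obtain x where x: "x \<in> cyclic_C (2 * m)"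
      and A: "A \<in> {qmat2 x 0 0 x, qmat2 0 x x 0, qmat2 (x * quat_j) 0 0 (- (x * quat_j)),
        qmat2 0 (x * quat_j) (- (x * quat_j)) 0}"
      unfolding G_D_psi1_eq[OF assms] diag_or_anti_def by blast
    have G: "diag_or_anti y y \<union> diag_or_anti (y * quat_j) (- (y * quat_j)) \<subseteq> G_D_psi1 m"
      if "y \<in> cyclic_C (2 * m)" for y
      using that unfolding G_D_psi1_eq[OF assms] by blast
    from A R_i_conj_diag_or_anti[OF cyclic_C_double(2,3)[OF assms x], of r]
      G[OF x] G[OF cyclic_C_double(1)[OF assms x]]
    show ?thesis
      unfolding conj_transpose_R_i diag_or_anti_def by auto
  qed
  \<comment> \<open>Conjugation by an involution is an involution, so mapping the group into itself
    already means mapping it onto itself.\<close>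
  have inv: "?f (?f A) = A" for A
    by (metis conj_transpose_R_i R_i_mult_self matrix_mul_assoc matrix_mul_lid matrix_mul_rid)
  have "?f ` G_D_psi1 m = G_D_psi1 m"
    using closed inv by (auto simp: image_iff) metis
  \<comment> \<open>The action behind \<open>normalizer\<close> is restricted to subsets of the
    carrier, hence the appeal to \<open>G_D_psi1_subset_U2H\<close>.\<close>
  then show ?thesis
    unfolding normalizer_def stabilizer_def
    by (simp add: R_i_in_U2H G_D_psi1_subset_U2H[OF assms] conjugate_set_U2H)
qed

lemma is_reflection_R_i: "is_reflection (R_i r)"
  unfolding is_reflection_def
proof (intro conjI exI)
  define s where "s = sqrt (1 + r\<^sup>2)"
  have s: "s > 0" "s * s = 1 + r\<^sup>2"
    using sqrt_1_plus_square[of r] by (simp_all add: s_def)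
  \<comment> \<open>The second row of the fixed-point equation gives
    \<open>x $ 2 = - (r i) (x $ 1) / (s + 1)\<close>. Scaling by \<open>s + 1\<close> yields
    \<open>v\<close>, whose first entry is positive for every \<open>r\<close>, including
    \<open>r = 0\<close>.\<close>
  define v :: "quat^2" where "v = vector [of_real (s + 1), - (r *\<^sub>R quat_i)]"
  have v: "v $ 1 = (s + 1) *\<^sub>R 1" "v $ 2 = - (r *\<^sub>R quat_i)"
    by (simp_all add: v_def of_real_def scaleR_add_left)
  show "R_i r \<in> carrier U2H" by (rule R_i_in_U2H)
  have "qRe (v $ 1) \<noteq> qRe 0" using s by (simp add: v)
  then show "v \<noteq> 0" by (metis zero_index)
  have comp: "(R_i r *v x) $ 1 = (1 / s) *\<^sub>R (x $ 1 + (r *\<^sub>R quat_i) * x $ 2)"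
    "(R_i r *v x) $ 2 = (1 / s) *\<^sub>R (- (r *\<^sub>R quat_i) * x $ 1 - x $ 2)" for x
    by (simp_all add: R_i_def scaleR_qmat2 matrix_vector_mult_def sum_2 s_def algebra_simps)
  have scale: "(1 / s) *\<^sub>R p = q \<longleftrightarrow> p = s *\<^sub>R q" for p q :: quat
    using s by (auto simp: field_simps)
  have fixed: "R_i r *v x = x \<longleftrightarrow>
      x $ 1 + (r *\<^sub>R quat_i) * x $ 2 = s *\<^sub>R (x $ 1) \<and> - (r *\<^sub>R quat_i) * x $ 1 - x $ 2 = s *\<^sub>R (x $ 2)" for x
    by (simp only: vec_eq_iff[where 'b = 2] forall_2 comp scale)
  show "{x. R_i r *v x = x} = {\<chi> l. v $ l * q | q. True}"
  proof (intro equalityI subsetI)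
    fix x assume "x \<in> {x. R_i r *v x = x}"
    then have "- (r *\<^sub>R quat_i) * x $ 1 = (s + 1) *\<^sub>R (x $ 2)"
      by (simp add: fixed scaleR_add_left algebra_simps)
    then have "x $ 2 = (1 / (s + 1)) *\<^sub>R (- (r *\<^sub>R quat_i) * x $ 1)"
      using s by simp
    then have "x = (\<chi> l. v $ l * ((1 / (s + 1)) *\<^sub>R (x $ 1)))"
      using s by (simp add: vec_eq_iff[where 'b = 2] forall_2 v)
    then show "x \<in> {\<chi> l. v $ l * q | q. True}" by blast
  next
    fix x assume "x \<in> {\<chi> l. v $ l * q | q. True}"
    then obtain q where "x = (\<chi> l. v $ l * q)" by blast
    then have x: "x $ 1 = (s + 1) *\<^sub>R q" "x $ 2 = - (r *\<^sub>R quat_i) * q"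
      by (simp_all add: v)
    \<comment> \<open>The relation \<open>s * s = 1 + r\<^sup>2\<close> in a form that rewrites
      inside nested products; it yields the first row of the fixed-point equation.\<close>
    have ss: "s * (s * a) = a + r * (r * a)" for a
      using s(2) unfolding mult.assoc[symmetric] by (simp add: algebra_simps power2_eq_square)
    show "x \<in> {x. R_i r *v x = x}"
      by (simp add: fixed x quat_eq_iff quat_sel_times algebra_simps ss)
  qed
qed

theorem theorem7p5:
  fixes m :: nat
  assumes "m \<ge> 1"
  shows "conjugate_in U2H (G_D_psi1 m) (G_C_inv m) \<and>
         conjugate_in U2H (G_C_inv m) (ST (2 * m) m) \<and>
         U2H\<lparr>carrier := G_C_inv m\<rparr> \<cong> U2H\<lparr>carrier := ST (2 * m) m\<rparr> \<and>
         (\<forall>r::real. is_reflection (R_i r) \<and> R_i r \<in> normalizer U2H (G_D_psi1 m))"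
proof -
  have m: "m > 0" using assms by simp
  \<comment> \<open>Since \<open>ST (2 * m) m\<close> equals \<open>G_C_inv m\<close>, the second
    conjugacy is by the identity matrix and the isomorphism is the identity map.\<close>
  show ?thesis
    using conjugate_G_D_psi1_G_C_inv[OF m] conjugate_in_U2H_refl[OF G_C_inv_subset_U2H[OF m]]
      R_i_in_normalizer[OF m] is_reflection_R_i iso_set_refl
    unfolding ST_eq_G_C_inv[OF m] is_iso_def by blast
qed

end
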